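(* Let $k_1,k_2,k,n_1,n_2,m$ be positive integers with $1\le k_i<n_i\le m$ for $i\in\{1,2\}$ and $k=k_1+k_2$. Let $\mathcal{S}_i$ be an $\mathbb{F}_{q^m}$-representation of $\mathcal{U}_{k_i,n_i}(q)$ for each $i\in\{1,2\}$ and let $X\in\mathbb{F}_{q^m}^{k_1\times n_2}$. If $\mathcal{S}_1\square_X\mathcal{S}_2$ is an $\mathbb{F}_{q^m}$-representation of $\mathcal{U}_{k_1,n_1}(q)\square\,\mathcal{U}_{k_2,n_2}(q)$, then $\mathcal{S}_1\square_X\mathcal{S}_2$ is $(\Lambda_{k-1,k_1},k-1)$-evasive; that is, $\dim_{\mathbb{F}_q}\big((\mathcal{S}_1\square_X\mathcal{S}_2)\cap H\big)\le k-1$ for every $(k-1)$-dimensional $\mathbb{F}_{q^m}$-subspace $H$ of $\mathbb{F}_{q^m}^k$ that does not contain $\mathbb{F}_{q^m}^{k_1}\oplus\mathbf{0}$.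
   Context: A $q$-matroid $M=(E,r)$ on a finite-dimensional $\mathbb{F}_q$-space $E$ is given by an integer-valued function $r$ on the subspaces of $E$ with (R1) $0\le r(A)\le\dim(A)$; (R2) $A\le B\Rightarrow r(A)\le r(B)$; (R3) $r(A+B)+r(A\cap B)\le r(A)+r(B)$. $A$ is independent if $r(A)=\dim A$. Isomorphism means a rank-preserving $\mathbb{F}_q$-linear isomorphism of ground spaces. $\mathcal{U}_{k,n}(q)$ is the $q$-matroid on $\mathbb{F}_q^n$ with rank function $A\mapsto\min\{k,\dim A\}$. An $[n,k]_{q^m/q}$ system is an $n$-dimensional $\mathbb{F}_q$-subspace $\mathcal{S}$ of $\mathbb{F}_{q^m}^k$ with $\langle\mathcal{S}\rangle_{\mathbb{F}_{q^m}}=\mathbb{F}_{q^m}^k$. For $V\le\mathcal{S}$ an $\mathbb{F}_q$-subspace, $r_{\mathcal{S}}(V)=\dim_{\mathbb{F}_{q^m}}\langle V\rangle_{\mathbb{F}_{q^m}}$; $(\mathcal{S},r_{\mathcal{S}})$ is a $q$-matroid. $\mathcal{S}$ is an $\mathbb{F}_{q^m}$-representation of a rank-$k$ $q$-matroid $M$ with $n$-dimensional ground space if $M\cong(\mathcal{S},r_{\mathcal{S}})$. Given an $[n_1,k_1]_{q^m/q}$ system $\mathcal{S}_1$, an $[n_2,k_2]_{q^m/q}$ system $\mathcal{S}_2$ with a fixed $\mathbb{F}_q$-basis $w_1,\dots,w_{n_2}$, and $X\in\mathbb{F}_{q^m}^{k_1\times n_2}$ with columns $x_1,\dots,x_{n_2}$,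 let $\mathcal{S}_1\square_X\mathcal{S}_2=\{(u,0):u\in\mathcal{S}_1\}+\langle(x_1,w_1),\dots,(x_{n_2},w_{n_2})\rangle_{\mathbb{F}_q}\le\mathbb{F}_{q^m}^{k_1+k_2}$, an $[n_1+n_2,k_1+k_2]_{q^m/q}$ system. For a collection $\mathcal{A}$ of $\mathbb{F}_q$-subspaces of $\mathbb{F}_{q^m}^k$, a system $\mathcal{S}$ is $(\mathcal{A},h)$-evasive if $\dim_{\mathbb{F}_q}(\mathcal{S}\cap A)\le h$ for all $A\in\mathcal{A}$. $\Lambda_{h,k_1}$ is the set of $h$-dimensional $\mathbb{F}_{q^m}$-subspaces of $\mathbb{F}_{q^m}^{k}=\mathbb{F}_{q^m}^{k_1}\oplus\mathbb{F}_{q^m}^{k_2}$ not containing $\mathbb{F}_{q^m}^{k_1}\oplus\mathbf{0}$. Free product: for $q$-matroids $M_i=(E_i,r_i)$, $i=1,2$, with projections $\pi_i:E_1\oplus E_2\to E_i$ and embeddings $\iota_i:E_i\to E_1\oplus E_2$, put $\lambda_1(A)=r_1(E_1)-r_1(A)$ and $\nu_2(B)=\dim(B)-r_2(B)$. $M_1\square M_2$ is the $q$-matroid on $E_1\oplus E_2$ whose independent spaces are exactly the $I\le E_1\oplus E_2$ with $\pi_1(I\cap\iota_1(E_1))$ independent in $M_1$ and $\lambda_1(\pi_1(I\cap\iota_1(E_1)))\ge\nu_2(\pi_2(I))$. *)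

theory Defs
  imports "HOL-Analysis.Analysis"
begin

text \<open>
  Vector spaces are given by an explicit scalar multiplication \<open>s\<close> on a type. A q-matroid lives on
  a subspace \<open>ground M\<close> of that type, and only the values of \<open>rk M\<close> on subspaces of
  \<open>ground M\<close> are meaningful. The order \<open>q\<close> is the cardinality of the scalar type.
\<close>

record 'v qmatroid =
  ground :: "'v set"
  rk :: "'v set \<Rightarrow> int"

locale q_matroid = vector_space s
  for s :: "'f::{field,finite} \<Rightarrow> 'v::ab_group_add \<Rightarrow> 'v" +
  fixes M :: "'v qmatroid"
  assumes subspace_ground: "subspace (ground M)"
    and finite_dim_ground: "\<exists>B. finite B \<and> span B = ground M"
    and R1: "\<And>A. subspace A \<Longrightarrow> A \<subseteq> ground M \<Longrightarrow> 0 \<le> rk M A \<and> rk M A \<le> int (dim A)"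
    and R2: "\<And>A B. subspace A \<Longrightarrow> subspace B \<Longrightarrow> B \<subseteq> ground M \<Longrightarrow> A \<subseteq> B \<Longrightarrow> rk M A \<le> rk M B"
    and R3: "\<And>A B. subspace A \<Longrightarrow> A \<subseteq> ground M \<Longrightarrow> subspace B \<Longrightarrow> B \<subseteq> ground M \<Longrightarrow>
               rk M {a + b | a b. a \<in> A \<and> b \<in> B} + rk M (A \<inter> B) \<le> rk M A + rk M B"

definition indep_space ::
  "('f::{field,finite} \<Rightarrow> 'v::ab_group_add \<Rightarrow> 'v) \<Rightarrow> 'v qmatroid \<Rightarrow> 'v set \<Rightarrow> bool" where
  "indep_space s M A \<longleftrightarrow>
     module.subspace s A \<and> A \<subseteq> ground M \<and> rk M A = int (vector_space.dim s A)"

definition q_isomorphic ::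
  "('f::{field,finite} \<Rightarrow> 'v::ab_group_add \<Rightarrow> 'v) \<Rightarrow> ('f \<Rightarrow> 'w::ab_group_add \<Rightarrow> 'w) \<Rightarrow>
     'v qmatroid \<Rightarrow> 'w qmatroid \<Rightarrow> bool" where
  "q_isomorphic s1 s2 M N \<longleftrightarrow>
     (\<exists>\<phi>. bij_betw \<phi> (ground M) (ground N) \<and>
          (\<forall>x\<in>ground M. \<forall>y\<in>ground M. \<phi> (x + y) = \<phi> x + \<phi> y) \<and>
          (\<forall>c. \<forall>x\<in>ground M. \<phi> (s1 c x) = s2 c (\<phi> x)) \<and>
          (\<forall>A. module.subspace s1 A \<and> A \<subseteq> ground M \<longrightarrow> rk N (\<phi> ` A) = rk M A))"

definition uniform_qmatroid :: "nat \<Rightarrow> ('f::{field,finite} ^ 'n) qmatroid" where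
  "uniform_qmatroid k = \<lparr>ground = UNIV, rk = (\<lambda>A. min (int k) (int (vec.dim A)))\<rparr>"

definition corank :: "'v qmatroid \<Rightarrow> 'v set \<Rightarrow> int" where
  "corank M A = rk M (ground M) - rk M A"

definition nullity ::
  "('f::{field,finite} \<Rightarrow> 'v::ab_group_add \<Rightarrow> 'v) \<Rightarrow> 'v qmatroid \<Rightarrow> 'v set \<Rightarrow> int" where
  "nullity s M B = int (vector_space.dim s B) - rk M B"

definition free_product_indep ::
  "('f::{field,finite} \<Rightarrow> 'v::ab_group_add \<Rightarrow> 'v) \<Rightarrow> ('f \<Rightarrow> 'w::ab_group_add \<Rightarrow> 'w) \<Rightarrow>
     'v qmatroid \<Rightarrow> 'w qmatroid \<Rightarrow> ('v \<times> 'w) set \<Rightarrow> bool" where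
  "free_product_indep s1 s2 M1 M2 I \<longleftrightarrow>
     module.subspace (module_prod.scale s1 s2) I \<and> I \<subseteq> ground M1 \<times> ground M2 \<and>
     indep_space s1 M1 (fst ` (I \<inter> (\<lambda>x. (x, 0)) ` ground M1)) \<and>
     corank M1 (fst ` (I \<inter> (\<lambda>x. (x, 0)) ` ground M1)) \<ge> nullity s2 M2 (snd ` I)"

text \<open>
  A q-matroid is determined by its independent spaces: the rank of \<open>A\<close> is the largest dimension
  of an independent space contained in \<open>A\<close>. The lemma \<open>indep_space_free_product\<close> below
  confirms that the independent spaces of the following structure are exactly the prescribed ones.
\<close>

definition free_product ::
  "('f::{field,finite} \<Rightarrow> 'v::ab_group_add \<Rightarrow> 'v) \<Rightarrow> ('f \<Rightarrow> 'w::ab_group_add \<Rightarrow> 'w) \<Rightarrow>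
     'v qmatroid \<Rightarrow> 'w qmatroid \<Rightarrow> ('v \<times> 'w) qmatroid" where
  "free_product s1 s2 M1 M2 =
     \<lparr>ground = ground M1 \<times> ground M2,
      rk = (\<lambda>A. Max {int (vector_space.dim (module_prod.scale s1 s2) I) | I.
                       free_product_indep s1 s2 M1 M2 I \<and> I \<subseteq> A})\<rparr>"

lemma (in vector_space) subspace_eq_if_dim_eq:
  assumes "subspace I" "subspace A" "I \<subseteq> A" "dim I = dim A" "finite B" "A \<subseteq> span B"
  shows "I = A"
proof -
  obtain C where C: "C \<subseteq> I" "independent C" "I \<subseteq> span C" "card C = dim I"
    by (rule basis_exists)
  obtain D where D: "C \<subseteq> D" "D \<subseteq> A" "independent D" "A \<subseteq> span D"
    using maximal_independent_subset_extend[of C A] C assms(3) by blast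
  have "finite D" using independent_span_bound[of B D] assms D by blast
  moreover have "card D = dim A" using basis_card_eq_dim D by blast
  ultimately have "C = D" using C D assms(4) card_subset_eq by metis
  then have "A \<subseteq> I" using D C assms(1) span_minimal by blast
  then show ?thesis using assms(3) by blast
qed

lemma indep_space_free_product:
  assumes "q_matroid s1 M1" and "q_matroid s2 M2"
  shows "indep_space (module_prod.scale s1 s2) (free_product s1 s2 M1 M2) I
           \<longleftrightarrow> free_product_indep s1 s2 M1 M2 I"
proof -
  interpret m1: q_matroid s1 M1 by fact
  interpret m2: q_matroid s2 M2 by fact
  interpret vector_space_prod s1 s2 by unfold_locales
  let ?F = "free_product_indep s1 s2 M1 M2"
  define dims where "dims A = {int (p.dim J) | J. ?F J \<and> J \<subseteq> A}" for A
  obtain B1 B2 where B: "finite B1" "m1.span B1 = ground M1" "finite B2" "m2.span B2 = ground M2"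
    using m1.finite_dim_ground m2.finite_dim_ground by blast
  define B where "B = (B1 \<times> {0}) \<union> ({0} \<times> B2)"
  have finB: "finite B" using B by (simp add: B_def)
  have spB: "ground M1 \<times> ground M2 \<subseteq> p.span B"
  proof
    fix z assume z: "z \<in> ground M1 \<times> ground M2"
    have "(fst z, 0) \<in> p.span (B1 \<times> {0})"
      using z B by (subst span_Times_sing2) auto
    moreover have "(0, snd z) \<in> p.span ({0} \<times> B2)"
      using z B by (subst span_Times_sing1) auto
    ultimately have "(fst z, 0) + (0, snd z) \<in> p.span B"
      unfolding B_def by (meson p.span_add p.span_mono subsetD Un_upper1 Un_upper2)
    then show "z \<in> p.span B" by simp
  qed
  have fin: "finite (dims A)" if "A \<subseteq> ground M1 \<times> ground M2" for A
  proof (rule finite_subset)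
    show "dims A \<subseteq> int ` {..card B}"
      unfolding dims_def using p.dim_le_card[OF _ finB] that spB by fastforce
  qed simp
  have zero: "?F {0}"
  proof -
    have 1: "(fst ` ({0} \<inter> (\<lambda>x. (x, 0::'c)) ` ground M1)) = {0}"
      using m1.subspace_0[OF m1.subspace_ground] by (force simp: zero_prod_def image_iff)
    have d: "m1.dim {0} = 0" "m2.dim {0} = 0"
      using m1.dim_le_card[of "{0}" "{}"] m2.dim_le_card[of "{0}" "{}"] by auto
    have r: "rk M1 {0} = 0" "rk M2 {0} = 0"
      using m1.R1[of "{0}"] m2.R1[of "{0}"] d m1.subspace_0[OF m1.subspace_ground]
        m2.subspace_0[OF m2.subspace_ground] m1.subspace_single_0 m2.subspace_single_0 by force+
    have "0 \<le> rk M1 (ground M1)"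
      using m1.R1[OF m1.subspace_ground] by simp
    then show ?thesis
      unfolding free_product_indep_def indep_space_def corank_def nullity_def 1
      using r d m1.subspace_0[OF m1.subspace_ground] m2.subspace_0[OF m2.subspace_ground]
      by (auto simp: zero_prod_def m1.subspace_single_0 p.subspace_single_0[unfolded zero_prod_def])
  qed
  have rkF: "rk (free_product s1 s2 M1 M2) A = Max (dims A)" for A
    by (simp add: free_product_def dims_def)
  show ?thesis
  proof
    assume I: "?F I"
    then have sub: "p.subspace I" "I \<subseteq> ground M1 \<times> ground M2"
      by (auto simp: free_product_indep_def)
    have "Max (dims I) = int (p.dim I)"
    proof (rule Max_eqI[OF fin[OF sub(2)]])
      show "int (p.dim I) \<in> dims I" using I by (auto simp: dims_def)
      fix y assume "y \<in> dims I"
      then obtain J where J: "J \<subseteq> I" "y = int (p.dim J)" by (auto simp: dims_def)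
      obtain C where C: "C \<subseteq> I" "p.independent C" "I \<subseteq> p.span C" "card C = p.dim I"
        by (rule p.basis_exists)
      have "finite C" using p.independent_span_bound[OF finB C(2)] C(1) sub(2) spB by blast
      then show "y \<le> int (p.dim I)"
        using p.dim_le_card[of J C] J C by auto
    qed
    then show "indep_space scale (free_product s1 s2 M1 M2) I"
      using sub by (simp add: indep_space_def rkF) (simp add: free_product_def)
  next
    assume "indep_space scale (free_product s1 s2 M1 M2) I"
    then have I: "p.subspace I" "I \<subseteq> ground M1 \<times> ground M2" "Max (dims I) = int (p.dim I)"
      by (auto simp: indep_space_def rkF) (auto simp: free_product_def)
    have "dims I \<noteq> {}" using zero p.subspace_0[OF I(1)] by (auto simp: dims_def)
    then have "int (p.dim I) \<in> dims I" using Max_in[OF fin[OF I(2)]] I(3) by metis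
    then obtain J where J: "?F J" "J \<subseteq> I" "p.dim J = p.dim I" by (auto simp: dims_def)
    then have "J = I"
      using p.subspace_eq_if_dim_eq[of J I B] finB spB I
      by (auto simp: free_product_indep_def)
    then show "?F I" using J by simp
  qed
qed

text \<open>
  The field extension is given by a unital ring homomorphism from the type of order \<open>q\<close> to the
  type of order \<open>q ^ m\<close>; it embeds \<open>\<bbbF>\<^sub>q\<close> as the unique subfield of that order.
\<close>

definition field_embedding :: "('f::field \<Rightarrow> 'l::field) \<Rightarrow> bool" where
  "field_embedding \<epsilon> \<longleftrightarrow>
     \<epsilon> 1 = 1 \<and> (\<forall>x y. \<epsilon> (x + y) = \<epsilon> x + \<epsilon> y) \<and> (\<forall>x y. \<epsilon> (x * y) = \<epsilon> x * \<epsilon> y)"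

definition base_scale :: "('f::field \<Rightarrow> 'l::field) \<Rightarrow> 'f \<Rightarrow> 'l ^ 'k \<Rightarrow> 'l ^ 'k" where
  "base_scale \<epsilon> c v = \<epsilon> c *s v"

definition is_system :: "('f::field \<Rightarrow> 'l::field) \<Rightarrow> nat \<Rightarrow> ('l ^ 'k) set \<Rightarrow> bool" where
  "is_system \<epsilon> n S \<longleftrightarrow>
     module.subspace (base_scale \<epsilon>) S \<and> vector_space.dim (base_scale \<epsilon>) S = n \<and>
     vec.span S = UNIV"

definition system_qmatroid :: "('l::field ^ 'k) set \<Rightarrow> ('l ^ 'k) qmatroid" where
  "system_qmatroid S = \<lparr>ground = S, rk = (\<lambda>V. int (vec.dim (vec.span V)))\<rparr>"

definition is_representation ::
  "('f::{field,finite} \<Rightarrow> 'l::field) \<Rightarrow> ('l ^ 'k) set \<Rightarrow>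
     ('f \<Rightarrow> 'v::ab_group_add \<Rightarrow> 'v) \<Rightarrow> 'v qmatroid \<Rightarrow> bool" where
  "is_representation \<epsilon> S s M \<longleftrightarrow>
     q_matroid s M \<and> rk M (ground M) = int CARD('k) \<and>
     is_system \<epsilon> (vector_space.dim s (ground M)) S \<and>
     q_isomorphic s (base_scale \<epsilon>) M (system_qmatroid S)"

definition is_ordered_basis ::
  "('f::field \<Rightarrow> 'l::field) \<Rightarrow> ('n \<Rightarrow> 'l ^ 'k) \<Rightarrow> ('l ^ 'k) set \<Rightarrow> bool" where
  "is_ordered_basis \<epsilon> w S \<longleftrightarrow>
     inj w \<and> \<not> module.dependent (base_scale \<epsilon>) (range w) \<and>
     module.span (base_scale \<epsilon>) (range w) = S"

definition join_vec :: "'a ^ 'k1 \<Rightarrow> 'a ^ 'k2 \<Rightarrow> 'a ^ ('k1 + 'k2)" where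
  "join_vec u v = (\<chi> i. case i of Inl a \<Rightarrow> u $ a | Inr b \<Rightarrow> v $ b)"

definition box_system ::
  "('f::field \<Rightarrow> 'l::field) \<Rightarrow> 'l ^ 'n2 ^ 'k1 \<Rightarrow> ('n2 \<Rightarrow> 'l ^ 'k2) \<Rightarrow> ('l ^ 'k1) set \<Rightarrow>
     ('l ^ ('k1 + 'k2)) set" where
  "box_system \<epsilon> X w S1 =
     {a + b | a b. a \<in> {join_vec u 0 | u. u \<in> S1} \<and>
                   b \<in> module.span (base_scale \<epsilon>) (range (\<lambda>j. join_vec (column j X) (w j)))}"

definition evasive ::
  "('f::field \<Rightarrow> 'l::field) \<Rightarrow> ('l ^ 'k) set set \<Rightarrow> nat \<Rightarrow> ('l ^ 'k) set \<Rightarrow> bool" where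
  "evasive \<epsilon> \<A> h S \<longleftrightarrow> (\<forall>A\<in>\<A>. vector_space.dim (base_scale \<epsilon>) (S \<inter> A) \<le> h)"

definition Lambda :: "nat \<Rightarrow> ('l::field ^ ('k1::finite + 'k2::finite)) set set" where
  "Lambda h = {H. vec.subspace H \<and> vec.dim H = h \<and> \<not> range (\<lambda>u :: 'l ^ 'k1. join_vec u 0) \<subseteq> H}"

end

theory Submission
  imports Defs
begin

text \<open>
  In a free product of uniform q-matroids of ranks \<open>k1\<close> and \<open>k2\<close>, every space of dimension at most
  \<open>k = k1 + k2\<close> that meets \<open>E1\<close> in dimension at most \<open>k1\<close> is independent. Hence
  \<open>E1\<close> is the only space of dimension \<open>n1 > k1\<close> and rank at most \<open>k1\<close>, and an arbitrary
  isomorphism onto \<open>S\<close>, the box system, must carry it to \<open>S1 \<oplus> 0\<close>. A hyperplane \<open>H\<close> not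
  containing the first summand cuts it in a hyperplane, so by uniformity of \<open>S1\<close> it meets
  \<open>S1 \<oplus> 0\<close> in dimension less than \<open>k1\<close>. If \<open>S \<inter> H\<close> had dimension at least \<open>k\<close>, it would
  therefore contain an independent space of dimension \<open>k\<close>, although its rank is at most
  \<open>dim H = k - 1\<close>.
\<close>

section \<open>Dimension over a finite field by counting vectors\<close>

lemma card_span_independent:
  fixes s :: "'f::{field,finite} \<Rightarrow> 'v::ab_group_add \<Rightarrow> 'v"
  assumes "vector_space s" and "finite B" and "\<not> module.dependent s B"
  shows "card (module.span s B) = CARD('f) ^ card B"
proof -
  interpret vector_space s by fact
  show ?thesis
    using assms(2,3)
  proof (induction B rule: finite_induct)
    case empty
    then show ?case by simp
  next
    case (insert b B)
    have ind: "independent B" "b \<notin> span B"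
      using insert by (auto simp: independent_insert)
    \<comment> \<open>As \<open>b\<close> lies outside \<open>span B\<close>, \<open>?f\<close> is a
      bijection onto the larger span; each new basis vector thus multiplies the number of elements
      by the order of the field.\<close>
    let ?f = "\<lambda>(c, x). s c b + x"
    have "span (insert b B) = ?f ` (UNIV \<times> span B)"
    proof (intro equalityI subsetI)
      fix y assume "y \<in> span (insert b B)"
      then obtain c where "y - s c b \<in> span B" by (auto simp: span_insert)
      then have "(c, y - s c b) \<in> UNIV \<times> span B" "y = ?f (c, y - s c b)" by auto
      then show "y \<in> ?f ` (UNIV \<times> span B)" by blast
    next
      fix y assume "y \<in> ?f ` (UNIV \<times> span B)"
      then obtain c x where "y = s c b + x" "x \<in> span B" by auto
      then show "y \<in> span (insert b B)" by (auto simp: span_insert intro!: exI[of _ c])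
    qed
    moreover have "inj_on ?f (UNIV \<times> span B)"
    proof (rule inj_onI, clarsimp)
      fix c x d y assume xy: "x \<in> span B" "y \<in> span B" "s c b + x = s d b + y"
      then have eq: "s (c - d) b = y - x" by (simp add: scale_left_diff_distrib algebra_simps)
      have "s (c - d) b \<in> span B" unfolding eq using xy by (simp add: span_diff)
      then have "s (inverse (c - d)) (s (c - d) b) \<in> span B" by (rule span_scale)
      then have "c = d" using ind(2) by (cases "c = d") simp_all
      then show "c = d \<and> x = y" using xy by simp
    qed
    ultimately have "card (span (insert b B)) = CARD('f) * card (span B)"
      by (simp add: card_image card_cartesian_product)
    then show ?case using insert ind by simp
  qed
qed

text \<open>Turns statements on dimensions into statements on cardinalities, which can be compared
  even between subspaces of different spaces.\<close>

lemma card_subspace: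
  fixes s :: "'f::{field,finite} \<Rightarrow> 'v::{ab_group_add,finite} \<Rightarrow> 'v"
  assumes "vector_space s" and "module.subspace s A"
  shows "card A = CARD('f) ^ vector_space.dim s A"
proof -
  interpret vector_space s by fact
  obtain B where B: "B \<subseteq> A" "independent B" "A \<subseteq> span B" "card B = dim A"
    by (rule basis_exists)
  then have "span B = A" using span_minimal assms(2) by blast
  then show ?thesis using card_span_independent[OF assms(1) _ B(2)] B(4) by simp
qed

lemma CARD_field_gt_1: "1 < CARD('f::{field,finite})"
proof -
  have "card {0, 1 :: 'f} \<le> CARD('f)" by (intro card_mono) auto
  then show ?thesis by simp
qed

lemma dim_mono_finite:
  fixes s :: "'f::{field,finite} \<Rightarrow> 'v::{ab_group_add,finite} \<Rightarrow> 'v"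
  assumes "vector_space s" and "module.subspace s A" and "module.subspace s B" and "A \<subseteq> B"
  shows "vector_space.dim s A \<le> vector_space.dim s B"
proof -
  have "CARD('f) ^ vector_space.dim s A \<le> CARD('f) ^ vector_space.dim s B"
    using assms by (simp flip: card_subspace add: card_mono)
  then show ?thesis using CARD_field_gt_1[where 'f='f] by simp
qed

lemma dim_strict_mono_finite:
  fixes s :: "'f::{field,finite} \<Rightarrow> 'v::{ab_group_add,finite} \<Rightarrow> 'v"
  assumes "vector_space s" and "module.subspace s A" and "module.subspace s B" and "A \<subset> B"
  shows "vector_space.dim s A < vector_space.dim s B"
proof -
  have "CARD('f) ^ vector_space.dim s A < CARD('f) ^ vector_space.dim s B"
    using assms by (simp flip: card_subspace add: psubset_card_mono)
  then show ?thesis using CARD_field_gt_1[where 'f='f] by simp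
qed

text \<open>Extend \<open>{v}\<close> to a basis of \<open>A\<close> and keep \<open>d - 1\<close>
  of the other basis vectors. Prescribing \<open>v\<close> makes it possible to force the result out
  of a given subspace.\<close>

lemma subspace_of_dim:
  fixes s :: "'f::{field,finite} \<Rightarrow> 'v::{ab_group_add,finite} \<Rightarrow> 'v"
  assumes "vector_space s" and "module.subspace s A" and "v \<in> A" and "v \<noteq> 0"
    and "1 \<le> d" and "d \<le> vector_space.dim s A"
  obtains I where "module.subspace s I" "I \<subseteq> A" "v \<in> I" "vector_space.dim s I = d"
proof -
  interpret vector_space s by fact
  have "independent {v}" using assms(4) by simp
  then obtain B where B: "{v} \<subseteq> B" "B \<subseteq> A" "independent B" "A \<subseteq> span B"
    using maximal_independent_subset_extend[of "{v}" A] assms(3) by blast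
  then have cB: "card B = dim A" using basis_card_eq_dim by blast
  then have "d - 1 \<le> card (B - {v})" using assms(6) B(1) by simp
  then obtain C where C: "C \<subseteq> B - {v}" "card C = d - 1"
    using obtain_subset_with_card_n by metis
  have sub: "insert v C \<subseteq> B" using C B by auto
  then have "independent (insert v C)" using B(3) independent_mono by blast
  moreover have "card (insert v C) = d" using C assms(5) by (subst card_insert_disjoint) auto
  ultimately have "dim (span (insert v C)) = d" by (metis dim_eq_card_independent dim_span)
  moreover have "span (insert v C) \<subseteq> A" using sub B(2) assms(2) span_minimal by (meson subset_trans)
  ultimately show ?thesis using that[of "span (insert v C)"] by (simp add: span_base)
qed

section \<open>Transport of subspaces and ranks along linear maps\<close>

lemma image_subspace_inj_on:
  fixes s1 :: "'f::{field,finite} \<Rightarrow> 'v::{ab_group_add,finite} \<Rightarrow> 'v"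
    and s2 :: "'f \<Rightarrow> 'w::{ab_group_add,finite} \<Rightarrow> 'w"
  assumes "vector_space s1" and "vector_space s2" and "module.subspace s1 A" and "inj_on \<phi> A"
    and add: "\<And>x y. x \<in> A \<Longrightarrow> y \<in> A \<Longrightarrow> \<phi> (x + y) = \<phi> x + \<phi> y"
    and scale: "\<And>c x. x \<in> A \<Longrightarrow> \<phi> (s1 c x) = s2 c (\<phi> x)"
  shows "module.subspace s2 (\<phi> ` A)"
    and "vector_space.dim s2 (\<phi> ` A) = vector_space.dim s1 A"
proof -
  interpret v1: vector_space s1 by fact
  interpret v2: vector_space s2 by fact
  have "\<phi> 0 = 0" using scale[of 0 0] v1.subspace_0[OF assms(3)] by simp
  then show sub: "v2.subspace (\<phi> ` A)"
    unfolding v2.subspace_def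
    using v1.subspace_0[OF assms(3)] v1.subspace_add[OF assms(3)] v1.subspace_scale[OF assms(3)]
    by (auto simp flip: add scale intro!: image_eqI[of 0 \<phi> 0])
  have "CARD('f) ^ v2.dim (\<phi> ` A) = CARD('f) ^ v1.dim A"
    using assms card_image sub by (metis card_subspace)
  then show "v2.dim (\<phi> ` A) = v1.dim A"
    using CARD_field_gt_1[where 'f='f] by simp
qed

text \<open>The witness \<open>\<psi>\<close> takes preimages under an isomorphism. Subspaces of
  \<open>N\<close> can then be studied inside \<open>M\<close>, and since preimages commute with
  intersections, so can the way they meet.\<close>

lemma q_isomorphic_preimage:
  fixes s1 :: "'f::{field,finite} \<Rightarrow> 'v::{ab_group_add,finite} \<Rightarrow> 'v"
    and s2 :: "'f \<Rightarrow> 'w::{ab_group_add,finite} \<Rightarrow> 'w"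
  assumes "vector_space s1" and "vector_space s2" and "ground M = UNIV"
    and "q_isomorphic s1 s2 M N"
  obtains \<psi> where "\<And>A. module.subspace s2 A \<Longrightarrow> A \<subseteq> ground N \<Longrightarrow> module.subspace s1 (\<psi> A)"
    and "\<And>A. module.subspace s2 A \<Longrightarrow> A \<subseteq> ground N \<Longrightarrow>
           vector_space.dim s1 (\<psi> A) = vector_space.dim s2 A"
    and "\<And>A. module.subspace s2 A \<Longrightarrow> A \<subseteq> ground N \<Longrightarrow> rk M (\<psi> A) = rk N A"
    and "\<And>A B. \<psi> (A \<inter> B) = \<psi> A \<inter> \<psi> B"
proof -
  interpret v1: vector_space s1 by fact
  interpret v2: vector_space s2 by fact
  obtain \<phi> where \<phi>: "bij_betw \<phi> UNIV (ground N)"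
    "\<And>x y. \<phi> (x + y) = \<phi> x + \<phi> y" "\<And>c x. \<phi> (s1 c x) = s2 c (\<phi> x)"
    "\<And>A. v1.subspace A \<Longrightarrow> rk N (\<phi> ` A) = rk M A"
    using assms(3,4) unfolding q_isomorphic_def by auto
  have 0: "\<phi> 0 = 0" using \<phi>(3)[of 0 0] by simp
  have sub: "v1.subspace (\<phi> -` A)" if "v2.subspace A" for A
    using that 0 unfolding v1.subspace_def v2.subspace_def by (auto simp: \<phi>)
  have img: "\<phi> ` (\<phi> -` A) = A" if "A \<subseteq> ground N" for A
    using \<phi>(1) that by (auto simp: bij_betw_def)
  have inj: "inj_on \<phi> A" for A
    using \<phi>(1) by (auto simp: bij_betw_def inj_on_def)
  show ?thesis
  proof
    fix A assume A: "v2.subspace A" "A \<subseteq> ground N"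
    show "v1.subspace (\<phi> -` A)" using A sub by blast
    show "v1.dim (\<phi> -` A) = v2.dim A"
      using image_subspace_inj_on(2)[OF assms(1,2) sub[OF A(1)] inj] \<phi> img[OF A(2)] by metis
    show "rk M (\<phi> -` A) = rk N A"
      using \<phi>(4)[OF sub[OF A(1)]] img[OF A(2)] by simp
  next
    show "\<phi> -` (A \<inter> B) = \<phi> -` A \<inter> \<phi> -` B" for A B by blast
  qed
qed

section \<open>Independent spaces in a free product of uniform q-matroids\<close>

text \<open>\<open>I\<close> itself is independent. If its part in the first summand has dimension
  \<open>j\<close>, that part has corank \<open>k1 - j\<close>, while the projection to the second
  summand has nullity at most \<open>max 0 (dim I - j - k2)\<close>, hence at most
  \<open>k1 - j\<close>.\<close>

lemma free_product_uniform_rank_ge: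
  fixes A I :: "(('f::{field,finite} ^ 'n1::finite) \<times> ('f ^ 'n2::finite)) set"
  defines "sc \<equiv> module_prod.scale ((*s) :: 'f \<Rightarrow> 'f ^ 'n1 \<Rightarrow> _) ((*s) :: 'f \<Rightarrow> 'f ^ 'n2 \<Rightarrow> _)"
  assumes "k1 \<le> CARD('n1)"
    and "module.subspace sc I" and "I \<subseteq> A"
    and "vector_space.dim sc I \<le> k1 + k2"
    and "vector_space.dim sc (I \<inter> UNIV \<times> {0}) \<le> k1"
  shows "int (vector_space.dim sc I) \<le>
           rk (free_product (*s) (*s) (uniform_qmatroid k1 :: ('f ^ 'n1) qmatroid)
                                      (uniform_qmatroid k2 :: ('f ^ 'n2) qmatroid)) A"
proof -
  interpret vector_space_prod "(*s) :: 'f \<Rightarrow> 'f ^ 'n1 \<Rightarrow> _" "(*s) :: 'f \<Rightarrow> 'f ^ 'n2 \<Rightarrow> _"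
    by unfold_locales
  note I = assms(3-)[unfolded sc_def]
  let ?J = "I \<inter> UNIV \<times> {0}"
  let ?F = "free_product_indep (*s) (*s) (uniform_qmatroid k1 :: ('f ^ 'n1) qmatroid)
                                      (uniform_qmatroid k2 :: ('f ^ 'n2) qmatroid)"
  have J: "p.subspace ?J"
    using I(1) by (auto simp: p.subspace_def scale_def zero_prod_def)
  have fst: "vec.subspace (fst ` ?J)" "vec.dim (fst ` ?J) = p.dim ?J"
    by (rule image_subspace_inj_on[OF p.vector_space_axioms vec.vector_space_axioms J];
        auto simp: inj_on_def scale_def)+
  obtain C where C: "C \<subseteq> ?J" "p.independent C" "?J \<subseteq> p.span C" "card C = p.dim ?J"
    by (rule p.basis_exists)
  obtain D where D: "C \<subseteq> D" "D \<subseteq> I" "p.independent D" "I \<subseteq> p.span D"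
    using p.maximal_independent_subset_extend[of C I] C by blast
  have cD: "card D = p.dim I" using p.basis_card_eq_dim D by blast
  have lin: "Vector_Spaces.linear scale (*s) (snd :: ('f ^ 'n1) \<times> ('f ^ 'n2) \<Rightarrow> _)"
    unfolding Vector_Spaces.linear_iff
    using p.vector_space_axioms vec.vector_space_axioms by (auto simp: scale_def)
  then interpret snd: Vector_Spaces.linear scale "(*s)" "snd :: ('f ^ 'n1) \<times> ('f ^ 'n2) \<Rightarrow> _" .
  have "snd ` I \<subseteq> vec.span (snd ` D)"
    using D(4) by (auto simp: snd.span_image)
  also have "\<dots> \<subseteq> vec.span (snd ` (D - C))"
  proof -
    have "snd ` D \<subseteq> insert 0 (snd ` (D - C))" using C(1) by force
    then show ?thesis by (metis vec.span_insert_0 vec.span_mono)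
  qed
  finally have "vec.dim (snd ` I) \<le> card (snd ` (D - C))"
    by (intro vec.dim_le_card) auto
  also have "\<dots> \<le> card (D - C)" by (intro card_image_le) simp
  also have "\<dots> = p.dim I - p.dim ?J"
    using D(1) C(4) cD by (simp add: card_Diff_subset)
  finally have snd: "vec.dim (snd ` I) \<le> p.dim I - p.dim ?J" .
  have E1: "I \<inter> range (\<lambda>x. (x, 0)) = ?J" by auto
  \<comment> \<open>The hypothesis \<open>k1 \<le> CARD('n1)\<close> makes the rank of the first
    ground space exactly \<open>k1\<close>, as the corank requires.\<close>
  have "?F I"
    unfolding free_product_indep_def indep_space_def corank_def nullity_def
    using I fst snd assms(2) by (auto simp: uniform_qmatroid_def E1 vec_dim_card simp del: vec.dim_UNIV)
  then show ?thesis
    using I(2) by (auto simp: free_product_def sc_def intro!: Max_ge)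
qed

section \<open>The space over the extension field, viewed over the base field\<close>

lemma vector_space_base_scale:
  assumes "field_embedding \<epsilon>"
  shows "vector_space (base_scale \<epsilon>)"
  using assms
  by unfold_locales
    (auto simp: base_scale_def field_embedding_def vec_eq_iff algebra_simps)

lemma subspace_base_scale:
  assumes "field_embedding \<epsilon>" and "vec.subspace H"
  shows "module.subspace (base_scale \<epsilon>) H"
proof -
  interpret vector_space "base_scale \<epsilon>" by (rule vector_space_base_scale) fact
  show ?thesis
    using assms(2) by (auto simp: subspace_def vec.subspace_def base_scale_def)
qed

lemma linear_join_vec_0: "Vector_Spaces.linear (*s) (*s) (\<lambda>u. join_vec u 0)"
  by (auto simp: Vector_Spaces.linear_iff vec.vector_space_axioms join_vec_def vec_eq_iff split: sum.split)

lemma inj_join_vec_0: "inj (\<lambda>u. join_vec u 0)"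
proof (rule injI)
  fix u v :: "'a ^ 'k1"
  assume eq: "join_vec u (0 :: 'a ^ 'k2) = join_vec v 0"
  have "u $ i = v $ i" for i
    using arg_cong[OF eq, of "\<lambda>x. x $ Inl i"] by (simp add: join_vec_def)
  then show "u = v" by (simp add: vec_eq_iff)
qed

section \<open>Hyperplane sections of the box system\<close>

theorem theorem5p14:
  fixes \<epsilon> :: "'f::{field,finite} \<Rightarrow> 'l::{field,finite}"
    and k1 k2 k n1 n2 m :: nat
    and S1 :: "('l ^ 'k1::finite) set" and S2 :: "('l ^ 'k2::finite) set"
    and w :: "'n2::finite \<Rightarrow> 'l ^ 'k2"
    and X :: "'l ^ 'n2 ^ 'k1"
  assumes "field_embedding \<epsilon>" and "CARD('l) = CARD('f) ^ m"
    and "CARD('k1) = k1" and "CARD('k2) = k2" and "CARD('n1::finite) = n1" and "CARD('n2) = n2"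
    and "0 < m"
    and "1 \<le> k1" and "k1 < n1" and "n1 \<le> m"
    and "1 \<le> k2" and "k2 < n2" and "n2 \<le> m"
    and "k = k1 + k2"
    and "is_representation \<epsilon> S1 (*s) (uniform_qmatroid k1 :: ('f ^ 'n1) qmatroid)"
    and "is_representation \<epsilon> S2 (*s) (uniform_qmatroid k2 :: ('f ^ 'n2) qmatroid)"
    and "is_ordered_basis \<epsilon> w S2"
    and "is_representation \<epsilon> (box_system \<epsilon> X w S1) (module_prod.scale (*s) (*s))
           (free_product (*s) (*s) (uniform_qmatroid k1 :: ('f ^ 'n1) qmatroid)
                                   (uniform_qmatroid k2 :: ('f ^ 'n2) qmatroid))"
  shows "evasive \<epsilon> (Lambda (k - 1) :: ('l ^ ('k1 + 'k2)) set set) (k - 1) (box_system \<epsilon> X w S1)"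
proof -
  interpret E: vector_space_prod "(*s) :: 'f \<Rightarrow> 'f ^ 'n1 \<Rightarrow> _" "(*s) :: 'f \<Rightarrow> 'f ^ 'n2 \<Rightarrow> _"
    by unfold_locales
  let ?U1 = "uniform_qmatroid k1 :: ('f ^ 'n1) qmatroid"
  let ?U2 = "uniform_qmatroid k2 :: ('f ^ 'n2) qmatroid"
  let ?M = "free_product (*s) (*s) ?U1 ?U2"
  let ?S = "box_system \<epsilon> X w S1"
  let ?j = "\<lambda>u :: 'l ^ 'k1. join_vec u (0 :: 'l ^ 'k2)"
  interpret b1: vector_space "base_scale \<epsilon> :: 'f \<Rightarrow> 'l ^ 'k1 \<Rightarrow> _"
    by (rule vector_space_base_scale) fact
  interpret b: vector_space "base_scale \<epsilon> :: 'f \<Rightarrow> 'l ^ ('k1 + 'k2) \<Rightarrow> _"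
    by (rule vector_space_base_scale) fact
  interpret j: Vector_Spaces.linear "(*s)" "(*s)" ?j by (rule linear_join_vec_0)
  have S1: "b1.subspace S1" "b1.dim S1 = n1"
    and S: "b.subspace ?S"
    using assms(15,18) \<open>CARD('n1) = n1\<close> vec_dim_card[where 'a='f and 'n='n1]
    unfolding is_representation_def is_system_def
    by (auto simp: uniform_qmatroid_def simp del: vec.dim_UNIV)
  have gM: "ground ?M = UNIV" by (simp add: free_product_def uniform_qmatroid_def)
  have iso: "q_isomorphic E.scale (base_scale \<epsilon>) ?M (system_qmatroid ?S)"
    using assms(18) by (simp add: is_representation_def)
  obtain \<psi> where \<psi>:
    "\<And>A. b.subspace A \<Longrightarrow> A \<subseteq> ?S \<Longrightarrow> E.p.subspace (\<psi> A)"
    "\<And>A. b.subspace A \<Longrightarrow> A \<subseteq> ?S \<Longrightarrow> E.p.dim (\<psi> A) = b.dim A"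
    "\<And>A. b.subspace A \<Longrightarrow> A \<subseteq> ?S \<Longrightarrow> rk ?M (\<psi> A) = int (vec.dim (vec.span A))"
    "\<And>A B. \<psi> (A \<inter> B) = \<psi> A \<inter> \<psi> B"
    by (rule q_isomorphic_preimage[OF E.p.vector_space_axioms b.vector_space_axioms gM iso,
          unfolded system_qmatroid_def qmatroid.simps]) (blast intro: that)
  have rank_S1: "vec.dim (vec.span K) = min k1 (b1.dim K)" if K: "b1.subspace K" "K \<subseteq> S1" for K
  proof -
    have gU: "ground ?U1 = UNIV" by (simp add: uniform_qmatroid_def)
    have iso1: "q_isomorphic (*s) (base_scale \<epsilon>) ?U1 (system_qmatroid S1)"
      using assms(15) by (simp add: is_representation_def)
    obtain \<theta> where
      "\<And>A. b1.subspace A \<Longrightarrow> A \<subseteq> S1 \<Longrightarrow> vec.dim (\<theta> A) = b1.dim A"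
      "\<And>A. b1.subspace A \<Longrightarrow> A \<subseteq> S1 \<Longrightarrow> rk ?U1 (\<theta> A) = int (vec.dim (vec.span A))"
      by (rule q_isomorphic_preimage[OF vec.vector_space_axioms b1.vector_space_axioms gU iso1,
            unfolded system_qmatroid_def qmatroid.simps]) (blast intro: that)
    from this[OF K]
    have "vec.dim (\<theta> K) = b1.dim K" "rk ?U1 (\<theta> K) = int (vec.dim (vec.span K))" by auto
    then show ?thesis by (simp add: uniform_qmatroid_def)
  qed
  have rank_ge: "int (E.p.dim I) \<le> rk ?M A"
    if "E.p.subspace I" "I \<subseteq> A" "E.p.dim I \<le> k" "E.p.dim (I \<inter> UNIV \<times> {0}) \<le> k1" for I A
    using free_product_uniform_rank_ge[of k1 I A k2] that assms by simp
  have j_image: "b.subspace (?j ` K)" "b.dim (?j ` K) = b1.dim K" if "b1.subspace K" for K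
    using image_subspace_inj_on[OF b1.vector_space_axioms b.vector_space_axioms that,
        of ?j] inj_on_subset[OF inj_join_vec_0]
    by (auto simp: j.add j.scale base_scale_def)
  let ?T = "?j ` S1"
  let ?E1 = "UNIV \<times> {0} :: (('f ^ 'n1) \<times> ('f ^ 'n2)) set"
  have T_sub: "?T \<subseteq> ?S"
  proof
    fix x assume "x \<in> ?T"
    then show "x \<in> ?S"
      unfolding box_system_def using b.span_zero by (force intro: exI[of _ x] exI[of _ 0])
  qed
  have T: "b.subspace ?T" "b.dim ?T = n1" using j_image S1 by auto
  have E1_eq: "?E1 = range (\<lambda>x. (x, 0))" by auto
  have E1: "E.p.subspace ?E1" "E.p.dim ?E1 = n1"
    unfolding E1_eq
    using image_subspace_inj_on[OF vec.vector_space_axioms E.p.vector_space_axioms vec.subspace_UNIV,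
        of "\<lambda>x. (x, 0)"] \<open>CARD('n1) = n1\<close>
    by (auto simp: inj_on_def E.scale_def vec_dim_card simp del: vec.dim_UNIV)
  have \<psi>T: "\<psi> ?T = ?E1"
  proof (rule ccontr)
    \<comment> \<open>Otherwise a vector outside \<open>E1\<close> extends to an independent subspace of dimension \<open>k1 + 1\<close>.\<close>
    assume neq: "\<psi> ?T \<noteq> ?E1"
    have sub: "E.p.subspace (\<psi> ?T)" and dim: "E.p.dim (\<psi> ?T) = n1"
      using \<psi> T T_sub by auto
    \<comment> \<open>Both spaces have dimension \<open>n1\<close>, so being different already
      yields a vector of \<open>\<psi> ?T\<close> outside \<open>?E1\<close>.\<close>
    have "\<not> \<psi> ?T \<subset> ?E1"
      using dim_strict_mono_finite[OF E.p.vector_space_axioms sub E1(1)] dim E1(2) by auto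
    then obtain v where v: "v \<in> \<psi> ?T" "v \<notin> ?E1" using neq by blast
    then have "v \<noteq> 0" by (auto simp: zero_prod_def)
    obtain I where I: "E.p.subspace I" "I \<subseteq> \<psi> ?T" "v \<in> I" "E.p.dim I = k1 + 1"
      using subspace_of_dim[OF E.p.vector_space_axioms sub v(1) \<open>v \<noteq> 0\<close>, of "k1 + 1"] dim assms
      by auto
    have "E.p.dim (I \<inter> ?E1) < E.p.dim I"
      using dim_strict_mono_finite[OF E.p.vector_space_axioms _ I(1), of "I \<inter> ?E1"] v I
        E.p.subspace_inter[OF I(1) E1(1)] by blast
    \<comment> \<open>The strict inequality bounds the intersection by \<open>k1\<close>, and
      \<open>1 \<le> k2\<close> gives \<open>k1 + 1 \<le> k\<close>.\<close>
    then have "int (k1 + 1) \<le> rk ?M (\<psi> ?T)"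
      using rank_ge[OF I(1,2)] I(4) assms by simp
    also have "\<dots> = int (vec.dim ?T)" using \<psi>(3)[OF T(1) T_sub] by simp
    also have "vec.dim ?T \<le> vec.dim S1" by (rule vec.dim_image_le) (rule linear_join_vec_0)
    also have "vec.dim S1 \<le> k1" using dim_subset_UNIV_cart_gen[of S1] assms(3) by simp
    finally show False by simp
  qed
  show ?thesis
    unfolding evasive_def
  proof
    fix H :: "('l ^ ('k1 + 'k2)) set" assume "H \<in> Lambda (k - 1)"
    then have H: "vec.subspace H" "vec.dim H = k - 1" "\<not> range ?j \<subseteq> H"
      by (auto simp: Lambda_def)
    have bH: "b.subspace H" by (rule subspace_base_scale) fact+
    let ?A = "?S \<inter> H"
    have A: "b.subspace ?A" using b.subspace_inter S bH by blast
    \<comment> \<open>Pulling the section of \<open>?T\<close> by \<open>H\<close> back to the first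
      summand makes the uniformity of \<open>S1\<close> applicable.\<close>
    define K where "K = S1 \<inter> ?j -` H"
    have W: "vec.subspace (?j -` H)" using j.subspace_vimage H(1) by blast
    have K: "b1.subspace K"
      unfolding K_def using b1.subspace_inter S1(1) subspace_base_scale[OF assms(1) W] by blast
    have "vec.span K \<subseteq> ?j -` H" using W vec.span_minimal K_def by blast
    then have "vec.span K \<noteq> UNIV" using H(3) by blast
    then have "vec.dim K \<noteq> CARD('k1)"
      by (metis vec.dim_eq_full vec.span_UNIV vec_dim_card)
    then have "vec.dim (vec.span K) < k1"
      using dim_subset_UNIV_cart_gen[of K] assms(3) by simp
    \<comment> \<open>By \<open>rank_S1\<close> the span has dimension
      \<open>min k1 (b1.dim K)\<close>; this is below \<open>k1\<close> only if
      \<open>b1.dim K\<close> is.\<close>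
    then have dimK: "b1.dim K < k1" using rank_S1[OF K] by (simp add: K_def)
    have AT: "?A \<inter> ?T = ?j ` K" using T_sub by (auto simp: K_def)
    show "b.dim ?A \<le> k - 1"
    proof (rule ccontr)
      assume "\<not> b.dim ?A \<le> k - 1"
      then have dimA: "k \<le> E.p.dim (\<psi> ?A)" using \<psi>(2)[OF A] by simp
      have sub: "E.p.subspace (\<psi> ?A)" using \<psi>(1)[OF A] by simp
      have "0 < E.p.dim (\<psi> ?A)" using dimA assms by simp
      \<comment> \<open>Any nonzero vector will do here: the intersection of \<open>I\<close> with
        \<open>?E1\<close> is controlled by that of \<open>\<psi> ?A\<close>, whatever
        \<open>I\<close> is chosen.\<close>
      then obtain v where v: "v \<in> \<psi> ?A" "v \<noteq> 0"
        using E.p.dim_le_card[of "\<psi> ?A" "{}"] by (auto simp: subset_iff)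
      obtain I where I: "E.p.subspace I" "I \<subseteq> \<psi> ?A" "E.p.dim I = k"
        using subspace_of_dim[OF E.p.vector_space_axioms sub v, of k] dimA assms by auto
      \<comment> \<open>Here \<open>?E1\<close> is replaced by \<open>\<psi> ?T\<close>, so that the
        intersection lies in the preimage of \<open>?A \<inter> ?T\<close>.\<close>
      have "I \<inter> ?E1 \<subseteq> \<psi> (?j ` K)" using I(2) \<psi>(4)[of ?A ?T] AT \<psi>T by auto
      moreover have jK: "b.subspace (?j ` K)" "?j ` K \<subseteq> ?S"
        using j_image(1)[OF K] AT by auto
      ultimately have "E.p.dim (I \<inter> ?E1) \<le> E.p.dim (\<psi> (?j ` K))"
        using dim_mono_finite[OF E.p.vector_space_axioms] \<psi>(1)
          E.p.subspace_inter[OF I(1) E1(1)] by blast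
      also have "\<dots> < k1" using \<psi>(2)[OF jK] j_image(2)[OF K] dimK by simp
      finally have "int k \<le> rk ?M (\<psi> ?A)" using rank_ge[OF I(1,2)] I(3) by simp
      also have "\<dots> = int (vec.dim ?A)" using \<psi>(3)[OF A] by simp
      also have "vec.dim ?A \<le> vec.dim H" by (rule vec.dim_subset) blast
      \<comment> \<open>Since \<open>k\<close> is positive, \<open>k - 1\<close> is not truncated
        and \<open>k \<le> k - 1\<close> is absurd.\<close>
      finally show False using H(2) assms by simp
    qed
  qed
qed

end
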